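(* For every $\alpha>0$, the function $x\mapsto K_\alpha(\sqrt{x})$ is logarithmically completely monotonic on $]0,\infty[$.
   Context: $K_\alpha$ is the modified Bessel function of the second kind, $K_\alpha(x)=\int_0^{\infty}e^{-x\cosh t}\cosh(\alpha t)\,dt$ for $x>0$. A function $f$ is logarithmically completely monotonic on an open interval $I$ if $f>0$ on $I$, $f$ has derivatives of all orders on $I$, and $(-1)^n[\ln f(x)]^{(n)}\ge0$ for all $x\in I$ and all integers $n\ge1$. *)

theory Defs
  imports "HOL-Analysis.Analysis"
begin

text \<open>The integral converges absolutely for every real order and every \<open>x > 0\<close>;
  for \<open>x \<le> 0\<close> the value is irrelevant.\<close>

definition bessel_K :: "real \<Rightarrow> real \<Rightarrow> real" where
  "bessel_K \<alpha> x = (LBINT t:{0..}. exp (- x * cosh t) * cosh (\<alpha> * t))"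

text \<open>Meant for an open interval \<open>I\<close>. Since \<open>I\<close> is open, the two-sided derivatives
  at points of \<open>I\<close> do not depend on the values of \<open>f\<close> outside \<open>I\<close>. The second conjunct
  is needed because \<^const>\<open>deriv\<close> is total.\<close>

definition log_completely_monotonic_on :: "real set \<Rightarrow> (real \<Rightarrow> real) \<Rightarrow> bool" where
  "log_completely_monotonic_on I f \<longleftrightarrow>
     (\<forall>x\<in>I. f x > 0) \<and>
     (\<forall>n. \<forall>x\<in>I. (deriv ^^ n) f differentiable (at x)) \<and>
     (\<forall>n\<ge>1. \<forall>x\<in>I. (-1) ^ n * (deriv ^^ n) (\<lambda>y. ln (f y)) x \<ge> 0)"

end

theory Submission
  imports Defs
begin

text \<open>Let \<open>y(x) = K\<^sub>\<alpha>(\<surd>x)\<close> and \<open>g(x) = -x y'(x) / y(x)\<close>, so that \<open>-(ln y)' = g(x) / x\<close>. The claim is that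
  \<open>g(x) / x\<close> is completely monotonic. The classical way is to represent it as a Stieltjes transform by
  complex analysis; the proof below stays with real differential equations.

  Bessel's equation (\<open>bessel_K_moment_ode\<close>, by integration by parts in the defining integral) turns
  into the Riccati equation \<open>x g' = g\<^sup>2 - (x + \<alpha>\<^sup>2) / 4\<close> (\<open>bessel_K_log_slope_riccati\<close>). Differentiating it
  \<open>n \<ge> 1\<close> times and using the integrating factor \<open>x\<^sup>n y\<^sup>2\<close> gives

  \<open>(x\<^sup>n y\<^sup>2 g\<^sup>(\<^sup>n\<^sup>))' = x\<^sup>n\<^sup>-\<^sup>1 y\<^sup>2 ((\<Sum>0<k<n. (n choose k) g\<^sup>(\<^sup>k\<^sup>) g\<^sup>(\<^sup>n\<^sup>-\<^sup>k\<^sup>)) - c\<^sub>n)\<close>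

  with \<open>c\<^sub>1 = 1/4\<close> and \<open>c\<^sub>n = 0\<close> for \<open>n > 1\<close>. The function under the derivative on the left tends to \<open>0\<close> at
  infinity: \<open>y\<close> decays like \<open>exp (-\<surd>x)\<close>, and \<open>g\<close> grows at most polynomially by the logarithmic
  convexity of \<open>K\<^sub>\<alpha>\<close>, and hence so do its derivatives. Therefore the sign of \<open>g\<^sup>(\<^sup>n\<^sup>)\<close> is opposite to
  the sign of the right-hand side, and by induction on \<open>n\<close> it is \<open>(-1)\<^sup>n\<^sup>-\<^sup>1\<close>
  (\<open>riccati_tower_alternating\<close>). In other words, the nonnegative function \<open>g\<close> has a completely
  monotonic derivative, that is, \<open>g\<close> is a Bernstein function, and then Taylor's theorem shows that
  \<open>g(x) / x\<close> is completely monotonic (\<open>Bernstein_div_id_completely_monotonic\<close>).\<close>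

section \<open>Moments of the integrand of the Bessel function\<close>

text \<open>Up to the sign \<open>(-1)\<^sup>j\<close> this is the \<open>j\<close>-th derivative of \<open>K\<^sub>\<alpha>\<close>, so that all the analysis of \<open>K\<^sub>\<alpha>\<close>
  can be done with a single family of integrals.\<close>

definition bessel_K_moment :: "real \<Rightarrow> nat \<Rightarrow> real \<Rightarrow> real" where
  "bessel_K_moment \<alpha> j s = (LBINT t:{0..}. exp (- s * cosh t) * cosh t ^ j * cosh (\<alpha> * t))"

lemma bessel_K_moment_0: "bessel_K_moment \<alpha> 0 = bessel_K \<alpha>"
  by (simp add: fun_eq_iff bessel_K_moment_def bessel_K_def)

text \<open>With \<open>u = cosh t\<close>, the factors other than the exponential, and an extra \<open>e\<^sup>t\<close>, are at most
  \<open>(2u)\<^sup>N\<close> for a suitable \<open>N\<close>, while \<open>u\<^sup>N e\<^sup>-\<^sup>s\<^sup>u \<le> N! / s\<^sup>N\<close> by the exponential series.\<close>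

lemma bessel_K_integrand_bound:
  fixes \<alpha> s :: real
  assumes "s > 0"
  obtains C where "C > 0"
    "\<And>t. t \<ge> 0 \<Longrightarrow> exp (- s * cosh t) * cosh t ^ j * cosh (\<alpha> * t) \<le> C * exp (- t)"
proof -
  define N where "N = j + nat \<lceil>\<bar>\<alpha>\<bar>\<rceil> + 1"
  have N: "real j + \<bar>\<alpha>\<bar> + 1 \<le> real N" unfolding N_def by linarith
  have "exp (- s * cosh t) * cosh t ^ j * cosh (\<alpha> * t) \<le> (2 ^ N * fact N / s ^ N) * exp (- t)"
    if t: "t \<ge> 0" for t
  proof -
    have c: "exp t \<le> 2 * cosh t" by (simp add: cosh_def field_simps)
    have "cosh t \<le> exp t" using t by (simp add: cosh_def field_simps)
    then have "cosh t ^ j \<le> exp t ^ j" by (intro power_mono) auto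
    also have "\<dots> = exp (real j * t)" by (simp add: exp_of_nat_mult)
    finally have 1: "cosh t ^ j \<le> exp (real j * t)" .
    have "cosh (\<alpha> * t) = cosh (\<bar>\<alpha>\<bar> * t)" by (simp add: abs_if)
    also have "\<dots> \<le> exp (\<bar>\<alpha>\<bar> * t)" using t by (simp add: cosh_def field_simps)
    finally have 2: "cosh (\<alpha> * t) \<le> exp (\<bar>\<alpha>\<bar> * t)" .
    have "cosh t ^ j * cosh (\<alpha> * t) * exp t \<le> exp (real j * t) * exp (\<bar>\<alpha>\<bar> * t) * exp t"
      by (intro mult_mono 1 2) auto
    also have "\<dots> = exp ((real j + \<bar>\<alpha>\<bar> + 1) * t)" by (simp add: exp_add [symmetric] algebra_simps)
    also have "\<dots> \<le> exp (real N * t)" using N t by (simp add: mult_right_mono)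
    also have "\<dots> = exp t ^ N" by (simp add: exp_of_nat_mult)
    also have "\<dots> \<le> (2 * cosh t) ^ N" by (intro power_mono c) auto
    finally have 3: "cosh t ^ j * cosh (\<alpha> * t) * exp t \<le> 2 ^ N * cosh t ^ N"
      by (simp add: power_mult_distrib)
    have "(s * cosh t) ^ N / fact N \<le> (\<Sum>k\<le>N. (s * cosh t) ^ k / fact k)"
      by (rule member_le_sum [where f = "\<lambda>k. (s * cosh t) ^ k / fact k"]) (use \<open>s > 0\<close> in auto)
    also have "\<dots> \<le> (\<Sum>k. (s * cosh t) ^ k / fact k)"
      using summable_exp_generic [of "s * cosh t"] \<open>s > 0\<close>
      by (intro sum_le_suminf) (auto simp: divide_inverse mult.commute)
    also have "\<dots> = exp (s * cosh t)"
      by (simp add: exp_def divide_inverse mult.commute)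
    finally have "s ^ N * cosh t ^ N \<le> fact N * exp (s * cosh t)"
      by (simp add: field_simps power_mult_distrib)
    then have 4: "cosh t ^ N * exp (- s * cosh t) \<le> fact N / s ^ N"
      using \<open>s > 0\<close> by (simp add: exp_minus field_simps)
    have "exp (- s * cosh t) * cosh t ^ j * cosh (\<alpha> * t)
        = exp (- s * cosh t) * exp (- t) * (cosh t ^ j * cosh (\<alpha> * t) * exp t)"
      by (simp add: exp_minus)
    also have "\<dots> \<le> exp (- s * cosh t) * exp (- t) * (2 ^ N * cosh t ^ N)"
      by (intro mult_left_mono 3) auto
    also have "\<dots> = 2 ^ N * exp (- t) * (cosh t ^ N * exp (- s * cosh t))" by simp
    also have "\<dots> \<le> 2 ^ N * exp (- t) * (fact N / s ^ N)"
      by (intro mult_left_mono 4) auto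
    finally show ?thesis by (simp add: mult_ac)
  qed
  moreover have "2 ^ N * fact N / s ^ N > 0" using \<open>s > 0\<close> by simp
  ultimately show ?thesis using that by blast
qed

lemma set_integrable_exp_minus: "set_integrable lborel {0..} (\<lambda>t::real. exp (- t))"
proof -
  have "(\<lambda>t::real. exp (- t)) absolutely_integrable_on {0..}"
    using integrable_on_exp_minus_to_infinity [of 1 0]
    by (intro nonnegative_absolutely_integrable_1) auto
  then show ?thesis
    unfolding set_integrable_def by (subst (asm) integrable_completion) auto
qed

lemma bessel_K_moment_integrable:
  fixes \<alpha> s :: real
  assumes "s > 0"
  shows "set_integrable lborel {0..} (\<lambda>t. exp (- s * cosh t) * cosh t ^ j * cosh (\<alpha> * t))"
proof -
  obtain C where C: "C > 0"
    "\<And>t. t \<ge> 0 \<Longrightarrow> exp (- s * cosh t) * cosh t ^ j * cosh (\<alpha> * t) \<le> C * exp (- t)"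
    by (rule bessel_K_integrand_bound [OF assms, where j = j and \<alpha> = \<alpha>]) blast
  show ?thesis
  proof (rule set_integrable_bound)
    show "set_integrable lborel {0..} (\<lambda>t. C * exp (- t))"
      using set_integrable_exp_minus by (intro set_integrable_mult_right) auto
    show "set_borel_measurable lborel {0..} (\<lambda>t. exp (- s * cosh t) * cosh t ^ j * cosh (\<alpha> * t))"
      unfolding set_borel_measurable_def by (auto intro!: borel_measurable_continuous_on_indicator continuous_intros simp del: real_scaleR_def)
  qed (use C in \<open>auto intro!: AE_I2 simp: abs_mult\<close>)
qed

lemma bessel_K_moment_pos:
  assumes "s > 0"
  shows "bessel_K_moment \<alpha> j s > 0"
proof -
  let ?f = "\<lambda>t. indicator {0..} t *\<^sub>R (exp (- s * cosh t) * cosh t ^ j * cosh (\<alpha> * t))"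
  have int: "integrable lborel ?f"
    using bessel_K_moment_integrable [OF assms] by (simp add: set_integrable_def)
  have nn: "AE t in lborel. 0 \<le> ?f t" by (auto simp: indicator_def)
  have "emeasure lborel {t \<in> space lborel. ?f t \<noteq> 0} \<ge> emeasure lborel {0..1::real}"
    by (intro emeasure_mono) (use int in \<open>auto simp: indicator_def\<close>)
  then have "\<not> (AE t in lborel. ?f t = 0)"
    using int by (subst AE_iff_measurable [OF _ refl]) auto
  then have "integral\<^sup>L lborel ?f \<noteq> 0"
    using integral_nonneg_eq_0_iff_AE [OF int nn] by blast
  moreover have "integral\<^sup>L lborel ?f \<ge> 0" using nn by (rule integral_nonneg_AE)
  ultimately show ?thesis
    unfolding bessel_K_moment_def set_lebesgue_integral_def by linarith
qed

text \<open>This second-order bound makes the difference quotients of the moments converge at a linear rate,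
  which replaces a dominated convergence argument.\<close>

lemma abs_exp_minus_linear_le: "\<bar>exp z - 1 - z\<bar> \<le> z\<^sup>2 * exp \<bar>z\<bar>" for z :: real
proof -
  have lo: "1 + z \<le> exp z" by simp
  have "(1 - z) * exp z \<le> exp (- z) * exp z"
    using exp_ge_add_one_self [of "- z"] by (intro mult_right_mono) auto
  then have "exp z - 1 - z \<le> z * (exp z - 1)" by (simp add: exp_minus algebra_simps)
  also have "z * (exp z - 1) \<le> z\<^sup>2 * exp \<bar>z\<bar>"
  proof (cases "z \<ge> 0")
    case True
    have "exp z - 1 \<le> z * exp z"
      using \<open>(1 - z) * exp z \<le> exp (- z) * exp z\<close> by (simp add: exp_minus algebra_simps)
    from mult_left_mono [OF this True] show ?thesis
      using True by (simp add: power2_eq_square mult_ac)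
  next
    case False
    have "z \<le> exp z - 1" using lo by linarith
    then have "z * (exp z - 1) \<le> z * z" using False by (intro mult_left_mono_neg) auto
    also have "\<dots> * 1 \<le> z\<^sup>2 * exp \<bar>z\<bar>"
      unfolding power2_eq_square by (intro mult_left_mono) auto
    finally show ?thesis by simp
  qed
  finally show ?thesis using lo by linarith
qed

text \<open>The error of the linear approximation with increment \<open>h\<close> is \<open>h\<^sup>2\<close> times at most a moment at \<open>s / 2\<close>:
  for \<open>\<bar>h\<bar> < s / 2\<close> the factor \<open>exp (\<bar>h\<bar> cosh t)\<close> from the remainder costs only half of the decay.\<close>

lemma bessel_K_moment_deriv:
  assumes s: "s > 0"
  shows "(bessel_K_moment \<alpha> j has_real_derivative - bessel_K_moment \<alpha> (Suc j) s) (at s)"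
proof -
  let ?w = "\<lambda>j s t. exp (- s * cosh t) * cosh t ^ j * cosh (\<alpha> * t)"
  define C where "C = bessel_K_moment \<alpha> (j + 2) (s / 2)"
  have bound: "\<bar>bessel_K_moment \<alpha> j (s + h) - bessel_K_moment \<alpha> j s
      + h * bessel_K_moment \<alpha> (Suc j) s\<bar> \<le> h\<^sup>2 * C" if h: "\<bar>h\<bar> < s / 2" for h
  proof -
    have pos: "s + h > 0" "s / 2 > 0" using h s by auto
    have pw: "\<bar>?w j (s + h) t - ?w j s t + h * ?w (Suc j) s t\<bar> \<le> h\<^sup>2 * ?w (j + 2) (s / 2) t" for t
    proof -
      have "?w j (s + h) t - ?w j s t + h * ?w (Suc j) s t
          = ?w j s t * (exp (- h * cosh t) - 1 - (- h * cosh t))"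
        by (simp add: algebra_simps flip: exp_add)
      then have "\<bar>?w j (s + h) t - ?w j s t + h * ?w (Suc j) s t\<bar>
          = ?w j s t * \<bar>exp (- h * cosh t) - 1 - (- h * cosh t)\<bar>" by (simp add: abs_mult)
      also have "\<dots> \<le> ?w j s t * ((- h * cosh t)\<^sup>2 * exp \<bar>- h * cosh t\<bar>)"
        by (intro mult_left_mono abs_exp_minus_linear_le) auto
      also have "\<dots> \<le> ?w j s t * ((- h * cosh t)\<^sup>2 * exp (s / 2 * cosh t))"
        using h by (intro mult_left_mono) (auto simp: abs_mult)
      also have "\<dots> = h\<^sup>2 * (cosh t ^ (j + 2) * cosh (\<alpha> * t) * (exp (- s * cosh t) * exp (s / 2 * cosh t)))"
        by (simp add: power_mult_distrib power_add power2_eq_square)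
      also have "exp (- s * cosh t) * exp (s / 2 * cosh t) = exp (- (s / 2) * cosh t)"
        by (simp add: exp_add [symmetric])
      finally show ?thesis by (simp add: mult_ac)
    qed
    have eq: "bessel_K_moment \<alpha> j (s + h) - bessel_K_moment \<alpha> j s + h * bessel_K_moment \<alpha> (Suc j) s
        = (LBINT t:{0..}. ?w j (s + h) t - ?w j s t + h * ?w (Suc j) s t)"
      unfolding bessel_K_moment_def using pos s
      by (simp only: set_integral_add set_integral_diff set_integral_mult_right
          set_integrable_mult_right bessel_K_moment_integrable)
    have err: "set_integrable lborel {0..} (\<lambda>t. ?w j (s + h) t - ?w j s t + h * ?w (Suc j) s t)"
      using pos s by (intro set_integral_add set_integral_diff set_integrable_mult_right bessel_K_moment_integrable)
    have "\<bar>LBINT t:{0..}. ?w j (s + h) t - ?w j s t + h * ?w (Suc j) s t\<bar>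
        \<le> (LBINT t:{0..}. \<bar>?w j (s + h) t - ?w j s t + h * ?w (Suc j) s t\<bar>)"
      using set_integral_norm_bound [OF err] by (simp only: real_norm_def)
    also have "\<dots> \<le> (LBINT t:{0..}. h\<^sup>2 * ?w (j + 2) (s / 2) t)"
      using pos s pw err
      by (intro set_integral_mono set_integrable_abs set_integrable_mult_right bessel_K_moment_integrable)
    also have "\<dots> = h\<^sup>2 * C" unfolding C_def bessel_K_moment_def by (simp only: set_integral_mult_right)
    finally show ?thesis using eq by simp
  qed
  have "(\<lambda>h. (bessel_K_moment \<alpha> j (s + h) - bessel_K_moment \<alpha> j s) / h - (- bessel_K_moment \<alpha> (Suc j) s)) \<midarrow>0\<rightarrow> 0"
  proof (rule Lim_null_comparison)
    show "((\<lambda>h. \<bar>h\<bar> * C) \<longlongrightarrow> 0) (at 0)" by (auto intro!: tendsto_eq_intros)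
    have "\<forall>\<^sub>F h in at 0. h \<in> {- (s / 2) <..< s / 2} \<and> h \<noteq> 0"
      using s by (intro eventually_conj eventually_at_in_open' eventually_neq_at_within) auto
    then show "\<forall>\<^sub>F h in at 0. norm ((bessel_K_moment \<alpha> j (s + h) - bessel_K_moment \<alpha> j s) / h
        - (- bessel_K_moment \<alpha> (Suc j) s)) \<le> \<bar>h\<bar> * C"
    proof eventually_elim
      case (elim h)
      have "norm ((bessel_K_moment \<alpha> j (s + h) - bessel_K_moment \<alpha> j s) / h
          - (- bessel_K_moment \<alpha> (Suc j) s))
        = \<bar>bessel_K_moment \<alpha> j (s + h) - bessel_K_moment \<alpha> j s + h * bessel_K_moment \<alpha> (Suc j) s\<bar> / \<bar>h\<bar>"
        using elim by (simp add: field_simps flip: abs_divide)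
      also have "\<dots> \<le> h\<^sup>2 * C / \<bar>h\<bar>"
        using elim by (intro divide_right_mono bound) auto
      also have "\<dots> = \<bar>h\<bar> * C" using elim by (simp add: power2_eq_square abs_if)
      finally show ?case .
    qed
  qed
  then show ?thesis by (metis DERIV_def LIM_zero_cancel)
qed

text \<open>Bessel's modified differential equation. The combination of the integrands is the
  \<open>t\<close>-derivative of \<open>exp (-s cosh t) (s sinh t cosh (\<alpha>t) + \<alpha> sinh (\<alpha>t))\<close>, which vanishes at both ends.\<close>

lemma bessel_K_moment_ode:
  assumes s: "s > 0"
  shows "s\<^sup>2 * bessel_K_moment \<alpha> 2 s - s * bessel_K_moment \<alpha> 1 s = (s\<^sup>2 + \<alpha>\<^sup>2) * bessel_K_moment \<alpha> 0 s"
proof -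
  let ?w = "\<lambda>j t. exp (- s * cosh t) * cosh t ^ j * cosh (\<alpha> * t)"
  define F where "F = (\<lambda>t. exp (- s * cosh t) * (s * sinh t * cosh (\<alpha> * t) + \<alpha> * sinh (\<alpha> * t)))"
  define f where "f = (\<lambda>t. (s\<^sup>2 + \<alpha>\<^sup>2) * ?w 0 t + s * ?w 1 t - s\<^sup>2 * ?w 2 t)"
  have int: "set_integrable lborel {0..} (?w j)" for j
    using bessel_K_moment_integrable [OF s] .
  have F: "(F has_real_derivative f t) (at t)" for t
  proof -
    have sq: "sinh t ^ 2 = cosh t ^ 2 - 1" by (simp add: cosh_square_eq)
    have "(F has_real_derivative exp (- s * cosh t) * (- s * sinh t)
          * (s * sinh t * cosh (\<alpha> * t) + \<alpha> * sinh (\<alpha> * t))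
        + exp (- s * cosh t) * (s * cosh t * cosh (\<alpha> * t) + s * sinh t * (\<alpha> * sinh (\<alpha> * t))
          + \<alpha> * (\<alpha> * cosh (\<alpha> * t)))) (at t)"
      unfolding F_def by (auto intro!: derivative_eq_intros simp: algebra_simps)
    also have "exp (- s * cosh t) * (- s * sinh t)
          * (s * sinh t * cosh (\<alpha> * t) + \<alpha> * sinh (\<alpha> * t))
        + exp (- s * cosh t) * (s * cosh t * cosh (\<alpha> * t) + s * sinh t * (\<alpha> * sinh (\<alpha> * t))
          + \<alpha> * (\<alpha> * cosh (\<alpha> * t)))
      = exp (- s * cosh t) * cosh (\<alpha> * t) * (s * cosh t + \<alpha>\<^sup>2 - s\<^sup>2 * sinh t ^ 2)"
      by (simp add: algebra_simps power2_eq_square)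
    also have "\<dots> = f t" unfolding sq f_def by (simp add: algebra_simps)
    finally show ?thesis .
  qed
  have F_lim: "(F \<longlongrightarrow> 0) at_top"
  proof -
    obtain C where C: "C > 0" "\<And>t. t \<ge> 0 \<Longrightarrow> ?w 1 t \<le> C * exp (- t)"
      by (rule bessel_K_integrand_bound [OF s, where j = 1 and \<alpha> = \<alpha>]) blast
    show ?thesis
    proof (rule Lim_null_comparison)
      show "((\<lambda>t. (s + \<bar>\<alpha>\<bar>) * (C * exp (- t))) \<longlongrightarrow> 0) at_top"
        by (intro tendsto_mult_right_zero filterlim_compose [OF exp_at_bot] filterlim_uminus_at_bot_at_top)
      show "\<forall>\<^sub>F t in at_top. norm (F t) \<le> (s + \<bar>\<alpha>\<bar>) * (C * exp (- t))"
        using eventually_ge_at_top [of "0::real"]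
      proof eventually_elim
        case (elim t)
        have sc: "\<bar>sinh u\<bar> \<le> cosh u" for u :: real
          using sinh_less_cosh_real [of u] sinh_less_cosh_real [of "- u"] by auto
        have "\<bar>s * sinh t * cosh (\<alpha> * t)\<bar> \<le> s * (cosh t * cosh (\<alpha> * t))"
          using s sc [of t] by (simp add: abs_mult)
        moreover have "\<bar>\<alpha> * sinh (\<alpha> * t)\<bar> \<le> \<bar>\<alpha>\<bar> * (cosh t * cosh (\<alpha> * t))"
        proof -
          have "\<bar>sinh (\<alpha> * t)\<bar> \<le> 1 * cosh (\<alpha> * t)" using sc by simp
          also have "\<dots> \<le> cosh t * cosh (\<alpha> * t)"
            by (intro mult_right_mono cosh_real_ge_1) auto
          finally show ?thesis by (simp add: abs_mult mult_left_mono)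
        qed
        ultimately have "\<bar>s * sinh t * cosh (\<alpha> * t) + \<alpha> * sinh (\<alpha> * t)\<bar>
            \<le> (s + \<bar>\<alpha>\<bar>) * (cosh t * cosh (\<alpha> * t))" by (simp add: distrib_right)
        then have "norm (F t) \<le> exp (- s * cosh t) * ((s + \<bar>\<alpha>\<bar>) * (cosh t * cosh (\<alpha> * t)))"
          unfolding F_def real_norm_def abs_mult by (intro mult_mono) auto
        also have "\<dots> = (s + \<bar>\<alpha>\<bar>) * ?w 1 t" by simp
        also have "\<dots> \<le> (s + \<bar>\<alpha>\<bar>) * (C * exp (- t))"
          using s by (intro mult_left_mono C elim) auto
        finally show ?case .
      qed
    qed
  qed
  have fint: "set_integrable lborel {0..} f"
    unfolding f_def using int by (intro set_integral_add set_integral_diff set_integrable_mult_right)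
  have "(LBINT t=ereal 0..\<infinity>. f t) = 0 - F 0"
  proof (rule interval_integral_FTC_integrable)
    show "(F has_vector_derivative f x) (at x)" for x
      using F by (simp add: has_real_derivative_iff_has_vector_derivative)
    show "isCont f x" for x unfolding f_def by (intro continuous_intros)
    show "set_integrable lborel (einterval (ereal 0) \<infinity>) f"
      using fint by (rule set_integrable_subset) (auto simp: einterval_def)
    show "((F \<circ> real_of_ereal) \<longlongrightarrow> F 0) (at_right (ereal 0))"
      using DERIV_isCont [OF F, of 0] unfolding ereal_tendsto_simps1
      by (simp add: isCont_def filterlim_at_split)
    show "((F \<circ> real_of_ereal) \<longlongrightarrow> 0) (at_left \<infinity>)"
      using F_lim by (simp add: ereal_tendsto_simps1)
  qed auto
  then have "(LBINT t:{0<..}. f t) = 0"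
    by (simp add: interval_integral_to_infinity_eq F_def)
  moreover have "(LBINT t:{0<..}. f t) = (LBINT t:{0..}. f t)"
    unfolding set_lebesgue_integral_def
  proof (rule integral_cong_AE)
    show "AE t in lborel. indicator {0<..} t *\<^sub>R f t = indicator {0..} t *\<^sub>R f t"
      using AE_lborel_singleton [of 0] by eventually_elim (auto simp: indicator_def)
  qed (auto simp: f_def intro!: borel_measurable_continuous_on_indicator continuous_intros simp del: real_scaleR_def)
  ultimately have "(LBINT t:{0..}. f t) = 0" by simp
  moreover have "(LBINT t:{0..}. f t) = (s\<^sup>2 + \<alpha>\<^sup>2) * bessel_K_moment \<alpha> 0 s
      + s * bessel_K_moment \<alpha> 1 s - s\<^sup>2 * bessel_K_moment \<alpha> 2 s"
    unfolding f_def bessel_K_moment_def using int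
    by (simp only: set_integral_add set_integral_diff set_integral_mult_right set_integrable_mult_right)
  ultimately show ?thesis by simp
qed

text \<open>The Cauchy--Schwarz inequality: the integral against \<open>(cosh t - L)\<^sup>2\<close> is nonnegative,
  with \<open>L\<close> the ratio of the two lower moments, which minimises it.\<close>

lemma bessel_K_moment_log_convex:
  assumes s: "s > 0"
  shows "(bessel_K_moment \<alpha> (Suc j) s)\<^sup>2 \<le> bessel_K_moment \<alpha> j s * bessel_K_moment \<alpha> (j + 2) s"
proof -
  let ?w = "\<lambda>j t. exp (- s * cosh t) * cosh t ^ j * cosh (\<alpha> * t)"
  let ?M = "\<lambda>j. bessel_K_moment \<alpha> j s"
  have int: "set_integrable lborel {0..} (?w j)" for j
    using bessel_K_moment_integrable [OF s] .
  define L where "L = ?M (Suc j) / ?M j"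
  have pos: "?M j > 0" using s by (rule bessel_K_moment_pos)
  have "0 \<le> (LBINT t:{0..}. ?w j t * (cosh t - L)\<^sup>2)"
    unfolding set_lebesgue_integral_def by (intro integral_nonneg_AE AE_I2) (auto simp: indicator_def)
  also have "(\<lambda>t. ?w j t * (cosh t - L)\<^sup>2) = (\<lambda>t. ?w (j + 2) t - 2 * L * ?w (Suc j) t + L\<^sup>2 * ?w j t)"
    by (simp add: fun_eq_iff power2_eq_square algebra_simps)
  also have "(LBINT t:{0..}. ?w (j + 2) t - 2 * L * ?w (Suc j) t + L\<^sup>2 * ?w j t)
      = ?M (j + 2) - 2 * L * ?M (Suc j) + L\<^sup>2 * ?M j"
    unfolding bessel_K_moment_def using int
    by (simp only: set_integral_add set_integral_diff set_integral_mult_right set_integrable_mult_right)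
  also have "\<dots> = ?M (j + 2) - (?M (Suc j))\<^sup>2 / ?M j"
    using pos unfolding L_def by (simp add: power2_eq_square field_simps)
  finally show ?thesis using pos by (simp add: field_simps)
qed

text \<open>The exponential decay comes from \<open>cosh t \<ge> 1\<close>.\<close>

lemma bessel_K_moment_decay:
  assumes "s \<ge> 1"
  shows "bessel_K_moment \<alpha> j s \<le> exp (1 - s) * bessel_K_moment \<alpha> j 1"
proof -
  have "(LBINT t:{0..}. exp (- s * cosh t) * cosh t ^ j * cosh (\<alpha> * t))
      \<le> (LBINT t:{0..}. exp (1 - s) * (exp (- 1 * cosh t) * cosh t ^ j * cosh (\<alpha> * t)))"
  proof (rule set_integral_mono)
    fix t :: real
    have "(s - 1) * 1 \<le> (s - 1) * cosh t"
      using assms by (intro mult_left_mono cosh_real_ge_1) auto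
    then have "exp (- s * cosh t) \<le> exp ((1 - s) + - 1 * cosh t)" by (simp add: algebra_simps)
    then have "exp (- s * cosh t) \<le> exp (1 - s) * exp (- 1 * cosh t)" by (simp only: exp_add)
    then have "exp (- s * cosh t) * (cosh t ^ j * cosh (\<alpha> * t))
        \<le> exp (1 - s) * exp (- 1 * cosh t) * (cosh t ^ j * cosh (\<alpha> * t))"
      by (rule mult_right_mono) auto
    then show "exp (- s * cosh t) * cosh t ^ j * cosh (\<alpha> * t)
        \<le> exp (1 - s) * (exp (- 1 * cosh t) * cosh t ^ j * cosh (\<alpha> * t))" by (simp add: mult_ac)
  next
    show "set_integrable lborel {0..} (\<lambda>t. exp (- s * cosh t) * cosh t ^ j * cosh (\<alpha> * t))"
      using assms by (intro bessel_K_moment_integrable) auto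
    show "set_integrable lborel {0..} (\<lambda>t. exp (1 - s) * (exp (- 1 * cosh t) * cosh t ^ j * cosh (\<alpha> * t)))"
      by (intro set_integrable_mult_right bessel_K_moment_integrable) auto
  qed
  then show ?thesis unfolding bessel_K_moment_def by (simp only: set_integral_mult_right)
qed

section \<open>Sequences of successive derivatives\<close>

text \<open>Explicit sequences of derivatives on the positive half-line let one prove smoothness and compute
  with higher derivatives at the same time; the iterated \<^const>\<open>deriv\<close> enters only at the end.\<close>

definition derivative_tower :: "(nat \<Rightarrow> real \<Rightarrow> real) \<Rightarrow> bool" where
  "derivative_tower D \<longleftrightarrow> (\<forall>n. \<forall>x>0. (D n has_real_derivative D (Suc n) x) (at x))"

lemma derivative_towerD:
  "derivative_tower D \<Longrightarrow> x > 0 \<Longrightarrow> (D n has_real_derivative D (Suc n) x) (at x)"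
  by (simp add: derivative_tower_def)

lemma derivative_tower_deriv_funpow:
  assumes D: "derivative_tower D" and f: "\<And>x. x > 0 \<Longrightarrow> f x = D 0 x"
  shows "x > 0 \<Longrightarrow> (deriv ^^ n) f x = D n x"
    and "x > 0 \<Longrightarrow> ((deriv ^^ n) f has_real_derivative D (Suc n) x) (at x)"
proof -
  have DERIV_iter: "((deriv ^^ n) f has_real_derivative D (Suc n) x) (at x)"
    if eq: "\<And>z. z > 0 \<Longrightarrow> (deriv ^^ n) f z = D n z" and x: "x > 0" for n x
  proof (rule DERIV_cong_ev [THEN iffD1, OF refl _ refl])
    show "(D n has_real_derivative D (Suc n) x) (at x)" using D x by (rule derivative_towerD)
    show "\<forall>\<^sub>F z in nhds x. D n z = (deriv ^^ n) f z"
      using eventually_nhds_in_open [of "{0<..}" x] x by (auto elim!: eventually_mono simp: eq)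
  qed
  have eq: "(deriv ^^ n) f z = D n z" if "z > 0" for n z
    using that
  proof (induction n arbitrary: z)
    case (Suc n)
    show ?case using DERIV_iter [OF Suc.IH Suc.prems] by (simp add: DERIV_imp_deriv)
  qed (simp add: f)
  then show "x > 0 \<Longrightarrow> (deriv ^^ n) f x = D n x" .
  show "x > 0 \<Longrightarrow> ((deriv ^^ n) f has_real_derivative D (Suc n) x) (at x)"
    using DERIV_iter eq by blast
qed

text \<open>The induction step of the Leibniz rule, by Pascal's identity.\<close>

lemma Leibniz_sum_Suc:
  fixes A B :: "nat \<Rightarrow> 'a :: comm_semiring_1"
  shows "(\<Sum>k\<le>n. of_nat (n choose k) * (A (Suc k) * B (n - k) + A k * B (Suc (n - k))))
    = (\<Sum>k\<le>Suc n. of_nat (Suc n choose k) * (A k * B (Suc n - k)))"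
proof -
  have "(\<Sum>k\<le>Suc n. of_nat (Suc n choose k) * (A k * B (Suc n - k)))
      = A 0 * B (Suc n) + (\<Sum>k\<le>n. of_nat (n choose k) * (A (Suc k) * B (n - k))
          + of_nat (n choose Suc k) * (A (Suc k) * B (n - k)))"
    by (simp add: sum.atMost_Suc_shift algebra_simps del: sum.atMost_Suc)
  also have "\<dots> = (\<Sum>k\<le>n. of_nat (n choose k) * (A (Suc k) * B (n - k)))
      + (A 0 * B (Suc n) + (\<Sum>k\<le>n. of_nat (n choose Suc k) * (A (Suc k) * B (n - k))))"
    by (simp add: sum.distrib algebra_simps)
  also have "A 0 * B (Suc n) + (\<Sum>k\<le>n. of_nat (n choose Suc k) * (A (Suc k) * B (n - k)))
      = (\<Sum>k\<le>Suc n. of_nat (n choose k) * (A k * B (Suc n - k)))"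
    by (simp add: sum.atMost_Suc_shift del: sum.atMost_Suc)
  also have "\<dots> = (\<Sum>k\<le>n. of_nat (n choose k) * (A k * B (Suc (n - k))))"
    by (simp add: Suc_diff_le binomial_eq_0)
  finally show ?thesis by (simp add: sum.distrib algebra_simps)
qed

lemma DERIV_Leibniz_sum:
  fixes A B :: "nat \<Rightarrow> real \<Rightarrow> real"
  assumes "\<And>k. k \<le> n \<Longrightarrow> (A k has_real_derivative A (Suc k) x) (at x)"
    and "\<And>k. k \<le> n \<Longrightarrow> (B k has_real_derivative B (Suc k) x) (at x)"
  shows "((\<lambda>x. \<Sum>k\<le>n. real (n choose k) * (A k x * B (n - k) x)) has_real_derivative
    (\<Sum>k\<le>Suc n. real (Suc n choose k) * (A k x * B (Suc n - k) x))) (at x)"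
proof -
  have "((\<lambda>x. \<Sum>k\<le>n. real (n choose k) * (A k x * B (n - k) x)) has_real_derivative
    (\<Sum>k\<le>n. real (n choose k) * (A (Suc k) x * B (n - k) x + A k x * B (Suc (n - k)) x))) (at x)"
    by (intro DERIV_sum DERIV_cmult) (auto intro!: derivative_eq_intros assms)
  then show ?thesis
    unfolding Leibniz_sum_Suc [where A = "\<lambda>k. A k x" and B = "\<lambda>k. B k x"] .
qed

text \<open>Repeated differentiation of \<open>f' = f R\<^sub>0\<close> by the Leibniz rule, where \<open>R\<close> lists the derivatives of
  \<open>R\<^sub>0\<close>. This gives the smoothness of \<open>f\<close> from that of its logarithmic derivative.\<close>

fun exp_tower :: "(real \<Rightarrow> real) \<Rightarrow> (nat \<Rightarrow> real \<Rightarrow> real) \<Rightarrow> nat \<Rightarrow> real \<Rightarrow> real" where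
  "exp_tower f R 0 x = f x"
| "exp_tower f R (Suc n) x = (\<Sum>k\<le>n. real (n choose k) * (exp_tower f R k x * R (n - k) x))"

lemma derivative_tower_exp_tower:
  assumes R: "derivative_tower R"
    and f: "\<And>x. x > 0 \<Longrightarrow> (f has_real_derivative f x * R 0 x) (at x)"
  shows "derivative_tower (exp_tower f R)"
proof -
  have "(exp_tower f R n has_real_derivative exp_tower f R (Suc n) x) (at x)" if x: "x > 0" for n x
  proof (induction n rule: less_induct)
    case (less n)
    show ?case
    proof (cases n)
      case 0
      have "exp_tower f R 0 = f" by (simp add: fun_eq_iff)
      then show ?thesis using f [OF x] 0 by simp
    next
      case (Suc m)
      have "((\<lambda>x. \<Sum>k\<le>m. real (m choose k) * (exp_tower f R k x * R (m - k) x)) has_real_derivative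
          (\<Sum>k\<le>Suc m. real (Suc m choose k) * (exp_tower f R k x * R (Suc m - k) x))) (at x)"
        by (rule DERIV_Leibniz_sum) (use less Suc R x in \<open>auto simp: derivative_tower_def simp del: exp_tower.simps\<close>)
      moreover have "exp_tower f R n = (\<lambda>x. \<Sum>k\<le>m. real (m choose k) * (exp_tower f R k x * R (m - k) x))"
        by (simp add: fun_eq_iff Suc)
      ultimately show ?thesis unfolding Suc by (simp only: exp_tower.simps)
    qed
  qed
  then show ?thesis by (simp add: derivative_tower_def)
qed

section \<open>Quotients of Bernstein functions by the identity\<close>

text \<open>The Leibniz formula for the \<open>n\<close>-th derivative of \<open>D\<^sub>0(x) / x\<close>. It is arranged so that the sum is the
  Taylor polynomial of \<open>D\<^sub>0\<close> about \<open>x\<close>, evaluated at \<open>0\<close>.\<close>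

definition div_id_tower :: "(nat \<Rightarrow> real \<Rightarrow> real) \<Rightarrow> nat \<Rightarrow> real \<Rightarrow> real" where
  "div_id_tower D n x = (-1) ^ n * fact n / x ^ Suc n * (\<Sum>k\<le>n. D k x / fact k * (- x) ^ k)"

lemma derivative_tower_div_id_tower:
  assumes D: "derivative_tower D"
  shows "derivative_tower (div_id_tower D)"
  unfolding derivative_tower_def
proof (intro allI impI)
  fix n and x :: real assume x: "x > 0"
  let ?P = "\<lambda>n x. \<Sum>k\<le>n. D k x / fact k * (- x) ^ k"
  \<comment> \<open>Differentiating the Taylor polynomial in its centre telescopes.\<close>
  have P: "(?P n has_real_derivative D (Suc n) x / fact n * (- x) ^ n) (at x)"
  proof (induction n)
    case 0
    then show ?case using derivative_towerD [OF D x, of 0] by simp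
  next
    case (Suc n)
    have pow: "((\<lambda>x. (- x) ^ Suc n) has_real_derivative - (real (Suc n) * (- x) ^ n)) (at x)"
      using DERIV_power [OF DERIV_minus [OF DERIV_ident], of "Suc n" x] by simp
    have "((\<lambda>x. ?P n x + D (Suc n) x / fact (Suc n) * (- x) ^ Suc n) has_real_derivative
        D (Suc n) x / fact n * (- x) ^ n
        + (D (Suc (Suc n)) x / fact (Suc n) * (- x) ^ Suc n
          + - (real (Suc n) * (- x) ^ n) * (D (Suc n) x / fact (Suc n)))) (at x)"
      by (intro DERIV_add Suc.IH DERIV_mult pow DERIV_cdivide derivative_towerD [OF D x])
    moreover have "D (Suc n) x / fact n * (- x) ^ n
        + (D (Suc (Suc n)) x / fact (Suc n) * (- x) ^ Suc n
          + - (real (Suc n) * (- x) ^ n) * (D (Suc n) x / fact (Suc n)))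
        = D (Suc (Suc n)) x / fact (Suc n) * (- x) ^ Suc n"
    proof -
      have "real (Suc n) / fact (Suc n) = 1 / fact n"
        by (simp only: fact_Suc) (simp del: of_nat_Suc)
      moreover have "(r * p) * (d / c) = (r / c) * (p * d)" for r p d c :: real by simp
      ultimately have "(real (Suc n) * (- x) ^ n) * (D (Suc n) x / fact (Suc n))
          = 1 / fact n * ((- x) ^ n * D (Suc n) x)" by (simp only:)
      then show ?thesis by (simp only: minus_mult_left [symmetric]) (simp add: mult_ac)
    qed
    ultimately show ?case by simp
  qed
  define c :: real where "c = (-1) ^ n * fact n"
  have "((\<lambda>x. c / x ^ Suc n) has_real_derivative
      (0 * x ^ Suc n - c * (real (Suc n) * x ^ n)) / (x ^ Suc n * x ^ Suc n)) (at x)"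
    using x DERIV_pow [of "Suc n" x] by (intro DERIV_divide) auto
  also have "(0 * x ^ Suc n - c * (real (Suc n) * x ^ n)) / (x ^ Suc n * x ^ Suc n)
      = - c * real (Suc n) / x ^ Suc (Suc n)"
    using x by (simp add: field_simps)
  also have "- c * real (Suc n) = (-1) ^ Suc n * fact (Suc n)" by (simp add: c_def)
  finally have "((\<lambda>x. (-1) ^ n * fact n / x ^ Suc n) has_real_derivative
      (-1) ^ Suc n * fact (Suc n) / x ^ Suc (Suc n)) (at x)" by (simp only: c_def)
  from DERIV_mult [OF this P]
  have "(div_id_tower D n has_real_derivative
      (-1) ^ Suc n * fact (Suc n) / x ^ Suc (Suc n) * ?P n x
      + D (Suc n) x / fact n * (- x) ^ n * ((-1) ^ n * fact n / x ^ Suc n)) (at x)"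
    by (simp only: div_id_tower_def [abs_def])
  also have "D (Suc n) x / fact n * (- x) ^ n * ((-1) ^ n * fact n / x ^ Suc n)
      = (-1) ^ Suc n * fact (Suc n) / x ^ Suc (Suc n) * (D (Suc n) x / fact (Suc n) * (- x) ^ Suc n)"
  proof -
    have cancel: "d / F * (- x) ^ m * ((-1) ^ m * F / x ^ Suc m) = d / x" if "F \<noteq> 0" for d F m
      using x that by (simp add: power_minus [of x] field_simps)
    show ?thesis
      using cancel [of "fact n" "D (Suc n) x" n] cancel [of "fact (Suc n)" "D (Suc n) x" "Suc n"]
      by (simp only: mult_ac fact_nonzero not_False_eq_True simp_thms)
  qed
  finally show "(div_id_tower D n has_real_derivative div_id_tower D (Suc n) x) (at x)"
    by (simp only: div_id_tower_def [of D "Suc n" x] sum.atMost_Suc distrib_left)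
qed

text \<open>If \<open>g = D\<^sub>0\<close> is nonnegative and \<open>g'\<close> is completely monotonic, then every Taylor polynomial of \<open>g\<close>
  about \<open>x\<close> lies above \<open>g\<close> to the left of \<open>x\<close>, because the remainder is nonpositive there. Hence its
  value at \<open>0\<close> is nonnegative, and up to a positive factor this value is the signed derivative of
  \<open>g(x) / x\<close>.\<close>

lemma Bernstein_div_id_completely_monotonic:
  assumes D: "derivative_tower D"
    and nonneg: "\<And>x. x > 0 \<Longrightarrow> D 0 x \<ge> 0"
    and alt: "\<And>n x. n \<ge> 1 \<Longrightarrow> x > 0 \<Longrightarrow> (-1) ^ n * D n x \<le> 0"
    and x: "x > 0"
  shows "(-1) ^ n * div_id_tower D n x \<ge> 0"
proof -
  \<comment> \<open>As \<open>g\<close> is controlled only on the open half-line, the polynomial is evaluated at \<open>e > 0\<close> first.\<close>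
  have *: "(\<Sum>k\<le>n. D k x / fact k * (e - x) ^ k) \<ge> 0" if e: "0 < e" "e < x" for e
  proof -
    obtain t where t: "e < t" "t < x"
      "D 0 e = (\<Sum>m<Suc n. D m x / fact m * (e - x) ^ m)
        + D (Suc n) t / fact (Suc n) * (e - x) ^ Suc n"
      using Taylor_down [of "Suc n" D "D 0" e x x] derivative_towerD [OF D] e by auto
    have "(e - x) ^ Suc n = (-1) ^ Suc n * (x - e) ^ Suc n"
      by (metis minus_diff_eq mult_minus1 power_mult_distrib)
    then have "D (Suc n) t / fact (Suc n) * (e - x) ^ Suc n
        = ((-1) ^ Suc n * D (Suc n) t) * ((x - e) ^ Suc n / fact (Suc n))" by simp
    also have "\<dots> \<le> 0"
      by (rule mult_nonpos_nonneg [OF alt]) (use t e in auto)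
    finally show ?thesis using t(3) nonneg [of e] e by (simp add: lessThan_Suc_atMost)
  qed
  have "(\<Sum>k\<le>n. D k x / fact k * (0 - x) ^ k) \<ge> 0"
  proof (rule tendsto_lowerbound)
    show "((\<lambda>e. \<Sum>k\<le>n. D k x / fact k * (e - x) ^ k) \<longlongrightarrow>
        (\<Sum>k\<le>n. D k x / fact k * (0 - x) ^ k)) (at_right 0)" by (intro tendsto_intros)
    show "\<forall>\<^sub>F e in at_right 0. 0 \<le> (\<Sum>k\<le>n. D k x / fact k * (e - x) ^ k)"
      unfolding eventually_at_right_field by (intro exI [of _ x] conjI allI impI x *)
  qed auto
  moreover have "(-1) ^ n * div_id_tower D n x
      = fact n / x ^ Suc n * (\<Sum>k\<le>n. D k x / fact k * (0 - x) ^ k)"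
    by (simp add: div_id_tower_def mult.assoc [symmetric] flip: power_mult_distrib)
  ultimately show ?thesis using x by simp
qed

section \<open>Functions of polynomial growth\<close>

text \<open>All derivatives of the solution of the Riccati equation must be negligible against exponential
  decay; a growth class closed under the operations of the recursion suffices.\<close>

definition poly_growth :: "(real \<Rightarrow> real) \<Rightarrow> bool" where
  "poly_growth f \<longleftrightarrow> (\<exists>m. f \<in> O(\<lambda>x. x ^ m))"

lemma poly_growth_const: "poly_growth (\<lambda>x. c)"
  unfolding poly_growth_def by (rule exI [of _ 0]) simp

lemma poly_growth_ident: "poly_growth (\<lambda>x. x)"
  unfolding poly_growth_def by (rule exI [of _ 1]) simp

lemma poly_growth_mult: "poly_growth f \<Longrightarrow> poly_growth g \<Longrightarrow> poly_growth (\<lambda>x. f x * g x)"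
  unfolding poly_growth_def by (metis (no_types, lifting) landau_o.big_mult power_add ext)

lemma poly_growth_add:
  assumes "poly_growth f" "poly_growth g"
  shows "poly_growth (\<lambda>x. f x + g x)"
proof -
  obtain a b where f: "f \<in> O(\<lambda>x. x ^ a)" and g: "g \<in> O(\<lambda>x. x ^ b)"
    using assms by (auto simp: poly_growth_def)
  have mono: "(\<lambda>x. x ^ i) \<in> O(\<lambda>x. x ^ (i + j) :: real)" for i j :: nat
    by (rule bigoI [of _ 1], use eventually_ge_at_top [of 1] in eventually_elim)
      (simp add: power_increasing)
  have "(\<lambda>x. f x + g x) \<in> O(\<lambda>x. x ^ (a + b))"
    using landau_o.big.trans [OF f mono [of a b]] landau_o.big.trans [OF g mono [of b a]]
    by (intro sum_in_bigo) (simp_all add: add.commute)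
  then show ?thesis unfolding poly_growth_def by blast
qed

lemma poly_growth_diff:
  assumes "poly_growth f" "poly_growth g"
  shows "poly_growth (\<lambda>x. f x - g x)"
  using poly_growth_add [OF assms(1) poly_growth_mult [OF poly_growth_const [of "-1"] assms(2)]] by simp

lemma poly_growth_sum:
  "finite A \<Longrightarrow> (\<And>i. i \<in> A \<Longrightarrow> poly_growth (f i)) \<Longrightarrow> poly_growth (\<lambda>x. \<Sum>i\<in>A. f i x)"
  by (induction A rule: finite_induct) (auto intro: poly_growth_const poly_growth_add)

lemma poly_growth_divide_ident:
  assumes "poly_growth f"
  shows "poly_growth (\<lambda>x. f x / x)"
proof -
  have "(\<lambda>x::real. 1 / x) \<in> O(\<lambda>x. x ^ 0)"
    by (rule bigoI [of _ 1], use eventually_ge_at_top [of 1] in eventually_elim) simp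
  then have "poly_growth (\<lambda>x. 1 / x)" unfolding poly_growth_def by blast
  from poly_growth_mult [OF assms this] show ?thesis by simp
qed

section \<open>Sign alternation of the derivatives of a Riccati solution\<close>

text \<open>The successive derivatives of \<open>(x + a) / 4\<close>.\<close>

definition riccati_inhom :: "real \<Rightarrow> nat \<Rightarrow> real \<Rightarrow> real" where
  "riccati_inhom a n x = (if n = 0 then (x + a) / 4 else if n = 1 then 1 / 4 else 0)"

text \<open>The derivatives of a solution \<open>u\<close> of \<open>x u' = u\<^sup>2 - (x + a) / 4\<close>: differentiating the equation
  \<open>n\<close> times gives \<open>x u\<^sup>(\<^sup>n\<^sup>+\<^sup>1\<^sup>) + n u\<^sup>(\<^sup>n\<^sup>)\<close> on the left and a Leibniz sum on the right.\<close>

fun riccati_tower :: "real \<Rightarrow> (real \<Rightarrow> real) \<Rightarrow> nat \<Rightarrow> real \<Rightarrow> real" where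
  "riccati_tower a u 0 x = u x"
| "riccati_tower a u (Suc n) x =
    ((\<Sum>k\<le>n. real (n choose k) * (riccati_tower a u k x * riccati_tower a u (n - k) x))
      - real n * riccati_tower a u n x - riccati_inhom a n x) / x"

lemma riccati_tower_0: "riccati_tower a u 0 = u"
  by (simp add: fun_eq_iff)

lemma derivative_tower_riccati_inhom: "derivative_tower (riccati_inhom a)"
  by (auto simp: derivative_tower_def riccati_inhom_def [abs_def] intro!: derivative_eq_intros)

lemma derivative_tower_riccati_tower:
  assumes u: "\<And>x. x > 0 \<Longrightarrow> (u has_real_derivative ((u x)\<^sup>2 - (x + a) / 4) / x) (at x)"
  shows "derivative_tower (riccati_tower a u)"
proof -
  let ?T = "riccati_tower a u"
  have "(?T n has_real_derivative ?T (Suc n) x) (at x)" if x: "x > 0" for n x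
  proof (induction n rule: less_induct)
    case (less n)
    show ?case
    proof (cases n)
      case 0
      then show ?thesis using u [OF x]
        by (simp add: riccati_tower_0 riccati_inhom_def power2_eq_square)
    next
      case (Suc m)
      let ?S = "\<lambda>m x. \<Sum>k\<le>m. real (m choose k) * (?T k x * ?T (m - k) x)"
      let ?N = "\<lambda>x. ?S m x - real m * ?T m x - riccati_inhom a m x"
      have "(?S m has_real_derivative ?S (Suc m) x) (at x)"
        by (rule DERIV_Leibniz_sum) (use less Suc in auto)
      then have "(?N has_real_derivative
          ?S (Suc m) x - real m * ?T (Suc m) x - riccati_inhom a (Suc m) x) (at x)"
        using less [of m] Suc
        by (intro DERIV_diff DERIV_cmult derivative_towerD [OF derivative_tower_riccati_inhom x]) auto
      from DERIV_divide [OF this DERIV_ident] x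
      have "((\<lambda>x. ?N x / x) has_real_derivative
          ((?S (Suc m) x - real m * ?T (Suc m) x - riccati_inhom a (Suc m) x) * x - ?N x * 1) / (x * x)) (at x)"
        by simp
      moreover have "?N x = x * ?T (Suc m) x" using x by simp
      then have "((?S (Suc m) x - real m * ?T (Suc m) x - riccati_inhom a (Suc m) x) * x - ?N x * 1) / (x * x)
          = (?S (Suc m) x - real (Suc m) * ?T (Suc m) x - riccati_inhom a (Suc m) x) / x"
        using x by (simp only: ) (simp add: field_simps del: riccati_tower.simps sum.atMost_Suc binomial_Suc_Suc)
      moreover have "?T n = (\<lambda>x. ?N x / x)" by (simp add: fun_eq_iff Suc)
      ultimately show ?thesis unfolding Suc by (simp only: riccati_tower.simps)
    qed
  qed
  then show ?thesis by (simp add: derivative_tower_def)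
qed

lemma poly_growth_riccati_tower:
  assumes "poly_growth u"
  shows "poly_growth (riccati_tower a u n)"
proof (induction n rule: less_induct)
  case (less n)
  show ?case
  proof (cases n)
    case 0
    then show ?thesis using assms by (simp add: riccati_tower_0)
  next
    case (Suc m)
    have T: "riccati_tower a u n = (\<lambda>x. ((\<Sum>k\<le>m. real (m choose k) *
        (riccati_tower a u k x * riccati_tower a u (m - k) x))
        - real m * riccati_tower a u m x - riccati_inhom a m x) / x)"
      by (simp add: fun_eq_iff Suc)
    have c: "poly_growth (riccati_inhom a m)"
      using poly_growth_mult [OF poly_growth_const [of "1/4"] poly_growth_add [OF poly_growth_ident poly_growth_const [of a]]]
      by (cases "m = 0"; cases "m = 1") (auto simp: riccati_inhom_def [abs_def] poly_growth_const)
    show ?thesis unfolding T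
      by (intro poly_growth_divide_ident poly_growth_diff poly_growth_sum poly_growth_mult
          poly_growth_const c less) (auto simp: Suc)
  qed
qed

text \<open>The heart of the proof. In the equation for \<open>u\<^sup>(\<^sup>n\<^sup>+\<^sup>1\<^sup>)\<close>, the two extreme terms of the Leibniz sum are
  \<open>2 u u\<^sup>(\<^sup>n\<^sup>)\<close>, and with \<open>y'/y = -u/x\<close> they are absorbed by the integrating factor \<open>x\<^sup>n y\<^sup>2\<close>:
  the derivative of \<open>W = x\<^sup>n y\<^sup>2 u\<^sup>(\<^sup>n\<^sup>)\<close> is \<open>x\<^sup>n\<^sup>-\<^sup>1 y\<^sup>2 S\<close>, where \<open>S\<close> contains only products
  \<open>u\<^sup>(\<^sup>k\<^sup>) u\<^sup>(\<^sup>n\<^sup>-\<^sup>k\<^sup>)\<close> with \<open>0 < k < n\<close>, and \<open>-1/4\<close> if \<open>n = 1\<close>. By the induction hypothesis \<open>S\<close> has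
  the sign \<open>(-1)\<^sup>n\<close>. So \<open>(-1)\<^sup>n W\<close> increases, to the limit \<open>0\<close> at infinity, and must be nonpositive.\<close>

lemma riccati_tower_alternating:
  assumes u: "\<And>x. x > 0 \<Longrightarrow> (u has_real_derivative ((u x)\<^sup>2 - (x + a) / 4) / x) (at x)"
    and y: "\<And>x. x > 0 \<Longrightarrow> (y has_real_derivative - (u x * y x / x)) (at x)"
    and y_nz: "\<And>x. x > 0 \<Longrightarrow> y x \<noteq> 0"
    and growth: "poly_growth u"
    and decay: "\<And>N. ((\<lambda>x. x ^ N * (y x)\<^sup>2) \<longlongrightarrow> 0) at_top"
  shows "n \<ge> 1 \<Longrightarrow> x > 0 \<Longrightarrow> (-1) ^ n * riccati_tower a u n x \<le> 0"
proof (induction n arbitrary: x rule: less_induct)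
  case (less n)
  let ?T = "riccati_tower a u"
  define S where "S = (\<lambda>x. (\<Sum>k\<in>{1..<n}. real (n choose k) * (?T k x * ?T (n - k) x)) - riccati_inhom a n x)"
  define W where "W = (\<lambda>x. x ^ n * (y x)\<^sup>2 * ?T n x)"
  have rec: "z * ?T (Suc n) z = 2 * u z * ?T n z - real n * ?T n z + S z" if "z > 0" for z
  proof -
    have "{..n} = insert 0 (insert n {1..<n})" using less.prems by auto
    then have "(\<Sum>k\<le>n. real (n choose k) * (?T k z * ?T (n - k) z))
        = 2 * u z * ?T n z + (\<Sum>k\<in>{1..<n}. real (n choose k) * (?T k z * ?T (n - k) z))"
      using less.prems by (simp add: riccati_tower_0)
    then show ?thesis using that by (simp add: S_def)
  qed
  have W': "(W has_real_derivative z ^ (n - 1) * (y z)\<^sup>2 * S z) (at z)" if z: "z > 0" for z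
  proof -
    have "(W has_real_derivative
        (real n * z ^ (n - 1) * (y z)\<^sup>2 + z ^ n * (2 * y z * - (u z * y z / z))) * ?T n z
        + z ^ n * (y z)\<^sup>2 * ?T (Suc n) z) (at z)"
      unfolding W_def
      by (auto intro!: derivative_eq_intros y [OF z] derivative_towerD [OF derivative_tower_riccati_tower [OF u] z]
          simp: algebra_simps simp del: riccati_tower.simps)
    moreover have "z ^ n = z * z ^ (n - 1)" using less.prems by (simp flip: power_Suc)
    then have "(real n * z ^ (n - 1) * (y z)\<^sup>2 + z ^ n * (2 * y z * - (u z * y z / z))) * ?T n z
        + z ^ n * (y z)\<^sup>2 * ?T (Suc n) z
      = z ^ (n - 1) * (y z)\<^sup>2 * (real n * ?T n z - 2 * u z * ?T n z + z * ?T (Suc n) z)"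
      using z by (simp add: field_simps power2_eq_square del: riccati_tower.simps)
    ultimately show ?thesis using rec [OF z] by simp
  qed
  have S_sign: "(-1) ^ n * S z \<ge> 0" if z: "z > 0" for z
  proof -
    have "(-1) ^ n * (real (n choose k) * (?T k z * ?T (n - k) z)) \<ge> 0" if k: "k \<in> {1..<n}" for k
    proof -
      have "((-1) ^ k * ?T k z) * ((-1) ^ (n - k) * ?T (n - k) z) \<ge> 0"
        using less.IH [of k z] less.IH [of "n - k" z] k z by (intro mult_nonpos_nonpos) auto
      moreover have "(-1) ^ n = (-1 :: real) ^ k * (-1) ^ (n - k)"
        using k by (simp flip: power_add)
      ultimately have "(-1) ^ n * (?T k z * ?T (n - k) z) \<ge> 0" by (simp only: mult_ac)
      then have "real (n choose k) * ((-1) ^ n * (?T k z * ?T (n - k) z)) \<ge> 0"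
        by (rule mult_nonneg_nonneg [OF of_nat_0_le_iff])
      then show ?thesis by (simp add: mult_ac)
    qed
    then have "(\<Sum>k\<in>{1..<n}. (-1) ^ n * (real (n choose k) * (?T k z * ?T (n - k) z))) \<ge> 0"
      by (rule sum_nonneg)
    moreover have "(-1) ^ n * riccati_inhom a n z \<le> 0"
      using less.prems by (simp add: riccati_inhom_def)
    ultimately show ?thesis by (simp add: S_def right_diff_distrib sum_distrib_left)
  qed
  have W_mono: "(-1) ^ n * W x \<le> (-1) ^ n * W z" if "x \<le> z" for z
  proof (rule DERIV_nonneg_imp_nondecreasing [OF that])
    fix t assume "x \<le> t" "t \<le> z"
    with less.prems have t: "t > 0" by simp
    have "((\<lambda>t. (-1) ^ n * W t) has_real_derivative
        (-1) ^ n * (t ^ (n - 1) * (y t)\<^sup>2 * S t)) (at t)"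
      by (intro DERIV_cmult W' t)
    moreover have "(-1) ^ n * (t ^ (n - 1) * (y t)\<^sup>2 * S t) \<ge> 0"
      using S_sign [OF t] t mult_nonneg_nonneg [of "t ^ (n - 1) * (y t)\<^sup>2" "(-1) ^ n * S t"]
      by (simp add: mult_ac)
    ultimately show "\<exists>d. ((\<lambda>t. (-1) ^ n * W t) has_real_derivative d) (at t) \<and> 0 \<le> d" by blast
  qed
  have "(W \<longlongrightarrow> 0) at_top"
  proof -
    obtain m where "?T n \<in> O(\<lambda>x. x ^ m)"
      using poly_growth_riccati_tower [OF growth, of a n] unfolding poly_growth_def by blast
    then obtain C where C: "\<forall>\<^sub>F x in at_top. norm (?T n x) \<le> C * norm (x ^ m)"
      by (auto simp: bigo_def)
    show ?thesis
    proof (rule Lim_null_comparison)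
      show "((\<lambda>x. C * (x ^ (n + m) * (y x)\<^sup>2)) \<longlongrightarrow> 0) at_top"
        by (intro tendsto_mult_right_zero decay)
      show "\<forall>\<^sub>F x in at_top. norm (W x) \<le> C * (x ^ (n + m) * (y x)\<^sup>2)"
        using C eventually_gt_at_top [of 0]
      proof eventually_elim
        case (elim x)
        then have "norm (W x) \<le> (x ^ n * (y x)\<^sup>2) * (C * x ^ m)"
          unfolding W_def norm_mult [of "x ^ n * (y x)\<^sup>2"] by (intro mult_mono) auto
        then show ?case by (simp add: power_add mult_ac)
      qed
    qed
  qed
  then have "((\<lambda>z. (-1) ^ n * W z) \<longlongrightarrow> 0) at_top" by (rule tendsto_mult_right_zero)
  moreover have "\<forall>\<^sub>F z in at_top. (-1) ^ n * W x \<le> (-1) ^ n * W z"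
    using eventually_ge_at_top [of x] by eventually_elim (rule W_mono)
  ultimately have "(-1) ^ n * W x \<le> 0"
    by (rule tendsto_lowerbound) simp
  moreover have "(-1) ^ n * W x = x ^ n * (y x)\<^sup>2 * ((-1) ^ n * ?T n x)" by (simp add: W_def)
  moreover have "x ^ n * (y x)\<^sup>2 > 0" using y_nz less.prems by simp
  ultimately show ?case by (metis mult_le_cancel_left_pos mult_zero_right)
qed

section \<open>The Bessel function of the square root\<close>

text \<open>With \<open>y(x) = K\<^sub>\<alpha>(\<surd>x)\<close> this is \<open>-x y'(x) / y(x)\<close>, as the first moment is \<open>-K\<^sub>\<alpha>'\<close>.\<close>

definition bessel_K_log_slope :: "real \<Rightarrow> real \<Rightarrow> real" where
  "bessel_K_log_slope \<alpha> x = sqrt x * bessel_K_moment \<alpha> 1 (sqrt x) / (2 * bessel_K_moment \<alpha> 0 (sqrt x))"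

lemma DERIV_bessel_K_moment_sqrt:
  assumes x: "x > 0"
  shows "((\<lambda>x. bessel_K_moment \<alpha> j (sqrt x)) has_real_derivative
    - bessel_K_moment \<alpha> (Suc j) (sqrt x) / (2 * sqrt x)) (at x)"
  using DERIV_chain2 [OF bessel_K_moment_deriv [of "sqrt x"] DERIV_real_sqrt [OF x]] x
  by (simp add: field_simps)

text \<open>A Riccati equation for the logarithmic derivative is the usual reduction of order of the linear
  equation of Bessel.\<close>

lemma bessel_K_log_slope_riccati:
  assumes x: "x > 0"
  shows "(bessel_K_log_slope \<alpha> has_real_derivative ((bessel_K_log_slope \<alpha> x)\<^sup>2 - (x + \<alpha>\<^sup>2) / 4) / x) (at x)"
proof -
  define s where "s = sqrt x"
  have s: "s > 0" and xs: "x = s\<^sup>2" using x by (auto simp: s_def)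
  let ?M = "\<lambda>j. bessel_K_moment \<alpha> j s"
  have M0: "?M 0 > 0" using s by (rule bessel_K_moment_pos)
  have sqrt': "(sqrt has_real_derivative 1 / (2 * sqrt x)) (at x)"
    using DERIV_real_sqrt [OF x] by (simp add: field_simps)
  have "(bessel_K_log_slope \<alpha> has_real_derivative
      ((1 / (2 * s) * ?M 1 + - ?M (Suc 1) / (2 * s) * s) * (2 * ?M 0)
        - s * ?M 1 * (2 * (- ?M (Suc 0) / (2 * s)))) / (2 * ?M 0 * (2 * ?M 0))) (at x)"
    unfolding bessel_K_log_slope_def [abs_def] s_def using M0
    by (intro DERIV_divide DERIV_mult DERIV_cmult DERIV_bessel_K_moment_sqrt [OF x] sqrt')
      (simp add: s_def)
  moreover have "((1 / (2 * s) * ?M 1 + - ?M (Suc 1) / (2 * s) * s) * (2 * ?M 0)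
        - s * ?M 1 * (2 * (- ?M (Suc 0) / (2 * s)))) / (2 * ?M 0 * (2 * ?M 0))
      = ((s * ?M 1 / (2 * ?M 0))\<^sup>2 - (s\<^sup>2 * ?M 2 - s * ?M 1) / (4 * ?M 0)) / s\<^sup>2"
    using s M0 by (simp add: field_simps power2_eq_square numeral_2_eq_2)
  moreover have "(s\<^sup>2 * ?M 2 - s * ?M 1) / (4 * ?M 0) = (x + \<alpha>\<^sup>2) / 4"
    using bessel_K_moment_ode [OF s] M0 by (simp add: xs)
  ultimately show ?thesis by (simp only: bessel_K_log_slope_def flip: s_def xs)
qed

lemma bessel_K_log_slope_nonneg: "x > 0 \<Longrightarrow> bessel_K_log_slope \<alpha> x \<ge> 0"
  using bessel_K_moment_pos [of "sqrt x"] by (simp add: bessel_K_log_slope_def less_imp_le)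

text \<open>Since \<open>K\<^sub>\<alpha>\<close> is logarithmically convex, \<open>-K\<^sub>\<alpha>'/K\<^sub>\<alpha>\<close> decreases and is bounded on \<open>[1,\<infinity>[\<close>.\<close>

lemma poly_growth_bessel_K_log_slope: "poly_growth (bessel_K_log_slope \<alpha>)"
proof -
  define q where "q = (\<lambda>s. bessel_K_moment \<alpha> 1 s / bessel_K_moment \<alpha> 0 s)"
  have q: "q s \<le> q 1" if s: "s \<ge> 1" for s
  proof (rule DERIV_nonpos_imp_nonincreasing [OF s])
    fix t :: real assume "1 \<le> t"
    then have t: "t > 0" by simp
    let ?M = "\<lambda>j. bessel_K_moment \<alpha> j t"
    have M0: "?M 0 > 0" using t by (rule bessel_K_moment_pos)
    have "(q has_real_derivative (- ?M (Suc 1) * ?M 0 - ?M 1 * - ?M (Suc 0)) / (?M 0 * ?M 0)) (at t)"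
      unfolding q_def using M0 by (intro DERIV_divide bessel_K_moment_deriv t) auto
    moreover have "(- ?M (Suc 1) * ?M 0 - ?M 1 * - ?M (Suc 0)) / (?M 0 * ?M 0) \<le> 0"
      using bessel_K_moment_log_convex [OF t, of \<alpha> 0] M0
      by (intro divide_nonpos_pos) (auto simp: power2_eq_square numeral_2_eq_2 mult_ac)
    ultimately show "\<exists>d. (q has_real_derivative d) (at t) \<and> d \<le> 0" by blast
  qed
  have "bessel_K_log_slope \<alpha> \<in> O(\<lambda>x. x ^ 1)"
  proof (rule bigoI [of _ "q 1 / 2"], use eventually_ge_at_top [of 1] in eventually_elim)
    case (elim x)
    have q0: "q s \<ge> 0" if "s > 0" for s
      using bessel_K_moment_pos [OF that] by (simp add: q_def less_imp_le)
    have "sqrt x * 1 \<le> sqrt x * sqrt x" using elim by (intro mult_left_mono) auto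
    then have sx: "sqrt x \<le> x" using elim by simp
    have "bessel_K_log_slope \<alpha> x = sqrt x * q (sqrt x) / 2" by (simp add: bessel_K_log_slope_def q_def)
    also have "\<dots> \<le> x * q 1 / 2"
      using sx q [of "sqrt x"] q0 [of "sqrt x"] elim by (intro divide_right_mono mult_mono) auto
    finally show "norm (bessel_K_log_slope \<alpha> x) \<le> q 1 / 2 * norm (x ^ 1)"
      using bessel_K_log_slope_nonneg [of x] elim by (simp add: mult_ac)
  qed
  then show ?thesis unfolding poly_growth_def by blast
qed

lemma bessel_K_sqrt_decay:
  "((\<lambda>x. x ^ N * (bessel_K_moment \<alpha> 0 (sqrt x))\<^sup>2) \<longlongrightarrow> 0) at_top"
proof (rule Lim_null_comparison)
  define C where "C = (exp 1 * bessel_K_moment \<alpha> 0 1)\<^sup>2"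
  show "((\<lambda>x. C * (sqrt x ^ (2 * N) / exp (sqrt x))) \<longlongrightarrow> 0) at_top"
    by (intro tendsto_mult_right_zero filterlim_compose [OF tendsto_power_div_exp_0 sqrt_at_top])
  show "\<forall>\<^sub>F x in at_top. norm (x ^ N * (bessel_K_moment \<alpha> 0 (sqrt x))\<^sup>2)
      \<le> C * (sqrt x ^ (2 * N) / exp (sqrt x))"
    using eventually_ge_at_top [of 1]
  proof eventually_elim
    case (elim x)
    have "(bessel_K_moment \<alpha> 0 (sqrt x))\<^sup>2 \<le> (exp (1 - sqrt x) * bessel_K_moment \<alpha> 0 1)\<^sup>2"
      using bessel_K_moment_pos [of "sqrt x" \<alpha> 0] elim
      by (intro power_mono bessel_K_moment_decay) auto
    also have "\<dots> = C * (1 / exp (sqrt x)) * (1 / exp (sqrt x))"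
      by (simp add: C_def exp_diff power2_eq_square)
    also have "\<dots> \<le> C * (1 / exp (sqrt x)) * 1"
      using elim by (intro mult_left_mono) (auto simp: C_def)
    finally have "x ^ N * (bessel_K_moment \<alpha> 0 (sqrt x))\<^sup>2 \<le> x ^ N * (C * (1 / exp (sqrt x)))"
      using elim by (intro mult_left_mono) auto
    moreover have "sqrt x ^ (2 * N) = x ^ N" using elim by (simp only: power_mult) simp
    ultimately show ?case using elim by (simp add: mult.commute)
  qed
qed

theorem proposition6:
  fixes \<alpha> :: real
  assumes "\<alpha> > 0"
  shows "log_completely_monotonic_on {0<..} (\<lambda>x. bessel_K \<alpha> (sqrt x))"
proof -
  define y where "y = (\<lambda>x. bessel_K \<alpha> (sqrt x))"
  have y_moment: "y = (\<lambda>x. bessel_K_moment \<alpha> 0 (sqrt x))"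
    by (simp add: y_def bessel_K_moment_0)
  have y_pos: "y x > 0" if "x > 0" for x
    using that bessel_K_moment_pos [of "sqrt x"] by (simp add: y_moment)
  have y_deriv: "(y has_real_derivative - (bessel_K_log_slope \<alpha> x * y x / x)) (at x)" if x: "x > 0" for x
  proof -
    have "- (bessel_K_log_slope \<alpha> x * y x / x) = - bessel_K_moment \<alpha> (Suc 0) (sqrt x) / (2 * sqrt x)"
      using x y_pos [OF x] by (simp add: y_moment bessel_K_log_slope_def field_simps)
    then show ?thesis
      using DERIV_bessel_K_moment_sqrt [OF x, of \<alpha> 0] by (simp only: y_moment)
  qed
  define T where "T = riccati_tower (\<alpha>\<^sup>2) (bessel_K_log_slope \<alpha>)"
  have T: "derivative_tower T"
    unfolding T_def by (rule derivative_tower_riccati_tower [OF bessel_K_log_slope_riccati])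
  have T_alt: "(-1) ^ n * T n x \<le> 0" if "n \<ge> 1" "x > 0" for n x
    unfolding T_def
  proof (rule riccati_tower_alternating [OF bessel_K_log_slope_riccati y_deriv _ poly_growth_bessel_K_log_slope _ that])
    show "((\<lambda>x. x ^ N * (y x)\<^sup>2) \<longlongrightarrow> 0) at_top" for N
      unfolding y_moment by (rule bessel_K_sqrt_decay)
  qed (use y_pos in force)+
  have T_0: "T 0 x = bessel_K_log_slope \<alpha> x" for x by (simp add: T_def)
  \<comment> \<open>\<open>R\<close> consists of the derivatives of \<open>-y'/y\<close>, and \<open>L\<close> of those of \<open>ln y\<close>.\<close>
  define R where "R = div_id_tower T"
  have R: "derivative_tower R" unfolding R_def using T by (rule derivative_tower_div_id_tower)
  have R_cm: "(-1) ^ n * R n x \<ge> 0" if "x > 0" for n x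
    unfolding R_def using bessel_K_log_slope_nonneg
    by (intro Bernstein_div_id_completely_monotonic T T_alt that) (simp_all add: T_0)
  have R_0: "R 0 x = bessel_K_log_slope \<alpha> x / x" for x by (simp add: R_def div_id_tower_def T_0)
  have mR: "derivative_tower (\<lambda>n x. - R n x)"
    using R by (auto simp: derivative_tower_def intro: DERIV_minus)
  define L where "L = (\<lambda>n x. case n of 0 \<Rightarrow> ln (y x) | Suc m \<Rightarrow> - R m x)"
  have L: "derivative_tower L"
    unfolding derivative_tower_def
  proof (intro allI impI)
    fix n and x :: real assume x: "x > 0"
    show "(L n has_real_derivative L (Suc n) x) (at x)"
    proof (cases n)
      case 0
      have "((\<lambda>x. ln (y x)) has_real_derivative - R 0 x) (at x)"
        using DERIV_chain2 [OF DERIV_ln_divide [OF y_pos [OF x]] y_deriv [OF x]] y_pos [OF x]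
        by (simp add: R_0)
      then show ?thesis by (simp add: L_def 0)
    next
      case (Suc m)
      then show ?thesis using derivative_towerD [OF mR x, of m] by (simp add: L_def)
    qed
  qed
  \<comment> \<open>Smoothness of \<open>y\<close> itself, as required in addition to that of its logarithm.\<close>
  have E: "derivative_tower (exp_tower y (\<lambda>n x. - R n x))"
    using y_deriv by (intro derivative_tower_exp_tower mR) (simp add: R_0 mult.commute)
  have "log_completely_monotonic_on {0<..} y"
    unfolding log_completely_monotonic_on_def
  proof (intro conjI ballI allI impI)
    fix x :: real assume "x \<in> {0<..}"
    then have x: "x > 0" by simp
    show "y x > 0" using y_pos [OF x] .
    show "(deriv ^^ n) y differentiable (at x)" for n
      using derivative_tower_deriv_funpow(2) [OF E _ x] by (auto simp: real_differentiable_def)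
    show "0 \<le> (-1) ^ n * (deriv ^^ n) (\<lambda>z. ln (y z)) x" if n1: "n \<ge> 1" for n
    proof -
      obtain m where n: "n = Suc m" using n1 by (cases n) auto
      have "(deriv ^^ n) (\<lambda>z. ln (y z)) x = L n x"
        using x by (intro derivative_tower_deriv_funpow(1) [OF L]) (simp_all add: L_def)
      then have "(-1) ^ n * (deriv ^^ n) (\<lambda>z. ln (y z)) x = (-1) ^ m * R m x"
        by (simp add: L_def n)
      then show ?thesis using R_cm [OF x] by simp
    qed
  qed
  then show ?thesis by (simp only: y_def)
qed

end
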